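(* Let $n\ge 2$ be an integer. The following linear inequality system in the variables $x_{ij}$, $0\le i<j\le n$, is totally dual integral: $x_{0n}\le 1$; $x_{in}\le x_{i-1,n}$ for all $i\in\{1,\dots,n-1\}$; $x_{0i}\le x_{0,i+1}$ for all $i\in\{1,\dots,n-1\}$; $x_{i-1,i+1}\le x_{i-1,i}+x_{i,i+1}$ for all $i\in\{1,\dots,n-1\}$; $x_{j,k}+x_{j+1,k-1}\le x_{j+1,k}+x_{j,k-1}$ for all $j,k\in\{0,\dots,n\}$ with $j<k-2$.
   Context: The variables are indexed by pairs $\{i,j\}\subseteq\{0,\dots,n\}$, written $x_{ij}$ with $i<j$. *)

theory Defs
  imports Complex_Main
begin

section \<open>Total dual integrality\<close>

text \<open>
  A linear inequality system has a finite set V of variables and a finite set R of rows; row r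
  is the inequality with coefficients \<open>A r\<close> and right-hand side \<open>b r\<close>. Vectors are functions, of
  which only the values on V (respectively R) matter.
\<close>

definition primal_feasible ::
    "'v set \<Rightarrow> 'r set \<Rightarrow> ('r \<Rightarrow> 'v \<Rightarrow> real) \<Rightarrow> ('r \<Rightarrow> real) \<Rightarrow> ('v \<Rightarrow> real) set" where
  "primal_feasible V R A b = {x. \<forall>r\<in>R. (\<Sum>v\<in>V. A r v * x v) \<le> b r}"

definition dual_feasible ::
    "'v set \<Rightarrow> 'r set \<Rightarrow> ('r \<Rightarrow> 'v \<Rightarrow> real) \<Rightarrow> ('v \<Rightarrow> real) \<Rightarrow> ('r \<Rightarrow> real) set" where
  "dual_feasible V R A c =
     {y. (\<forall>r\<in>R. 0 \<le> y r) \<and> (\<forall>v\<in>V. (\<Sum>r\<in>R. y r * A r v) = c v)}"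

text \<open>
  The notion is reserved for rational systems. For every integral objective c for which
  \<open>max {c x | A x \<le> b}\<close> is finite (the program is feasible and bounded), the dual
  \<open>min {y b | y \<ge> 0, y A = c}\<close> must have an integral optimal solution. Optimality is among all
  real dual solutions.
\<close>

definition totally_dual_integral ::
    "'v set \<Rightarrow> 'r set \<Rightarrow> ('r \<Rightarrow> 'v \<Rightarrow> real) \<Rightarrow> ('r \<Rightarrow> real) \<Rightarrow> bool" where
  "totally_dual_integral V R A b \<longleftrightarrow>
     finite V \<and> finite R \<and> (\<forall>r\<in>R. b r \<in> \<rat> \<and> (\<forall>v\<in>V. A r v \<in> \<rat>)) \<and>
     (\<forall>c. (\<forall>v\<in>V. c v \<in> \<int>) \<longrightarrow>
        primal_feasible V R A b \<noteq> {} \<longrightarrow>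
        bdd_above ((\<lambda>x. \<Sum>v\<in>V. c v * x v) ` primal_feasible V R A b) \<longrightarrow>
        (\<exists>y\<in>dual_feasible V R A c. (\<forall>r\<in>R. y r \<in> \<int>) \<and>
           (\<forall>z\<in>dual_feasible V R A c. (\<Sum>r\<in>R. y r * b r) \<le> (\<Sum>r\<in>R. z r * b r))))"

section \<open>The inequality system\<close>

definition pair_vars :: "nat \<Rightarrow> (nat \<times> nat) set" where
  "pair_vars n = {(i, j). i < j \<and> j \<le> n}"

datatype ineq = Upper | To_End nat | From_Start nat | Triangle nat | Exchange nat nat

definition ineqs :: "nat \<Rightarrow> ineq set" where
  "ineqs n = {Upper} \<union> To_End ` {1..n-1} \<union> From_Start ` {1..n-1} \<union> Triangle ` {1..n-1} \<union>
     {Exchange j k | j k. k \<le> n \<and> j + 2 < k}"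

definition unit_vec :: "nat \<Rightarrow> nat \<Rightarrow> nat \<times> nat \<Rightarrow> real" where
  "unit_vec i j = (\<lambda>v. if v = (i, j) then 1 else 0)"

text \<open>All variables are moved to the left-hand side of each inequality.\<close>

fun ineq_coeff :: "nat \<Rightarrow> ineq \<Rightarrow> nat \<times> nat \<Rightarrow> real" where
  "ineq_coeff n Upper v = unit_vec 0 n v"
| "ineq_coeff n (To_End i) v = unit_vec i n v - unit_vec (i-1) n v"
| "ineq_coeff n (From_Start i) v = unit_vec 0 i v - unit_vec 0 (i+1) v"
| "ineq_coeff n (Triangle i) v =
     unit_vec (i-1) (i+1) v - unit_vec (i-1) i v - unit_vec i (i+1) v"
| "ineq_coeff n (Exchange j k) v =
     unit_vec j k v + unit_vec (j+1) (k-1) v - unit_vec (j+1) k v - unit_vec j (k-1) v"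

fun ineq_rhs :: "ineq \<Rightarrow> real" where
  "ineq_rhs Upper = 1"
| "ineq_rhs (To_End i) = 0"
| "ineq_rhs (From_Start i) = 0"
| "ineq_rhs (Triangle i) = 0"
| "ineq_rhs (Exchange j k) = 0"

lemma finite_pair_vars: "finite (pair_vars n)"
  by (rule finite_subset[of _ "{..n} \<times> {..n}"]) (auto simp: pair_vars_def)

lemma sum_unit_vec:
  assumes "i < j" "j \<le> n"
  shows "(\<Sum>v\<in>pair_vars n. unit_vec i j v * x v) = x (i, j)"
proof -
  have "(\<Sum>v\<in>pair_vars n. unit_vec i j v * x v) = (\<Sum>v\<in>pair_vars n. if v = (i, j) then x v else 0)"
    by (rule sum.cong) (auto simp: unit_vec_def)
  also have "\<dots> = x (i, j)"
    using assms by (simp add: finite_pair_vars) (simp add: pair_vars_def)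
  finally show ?thesis .
qed

lemma primal_feasible_ineqs_iff:
  assumes "n \<ge> 2"
  shows "x \<in> primal_feasible (pair_vars n) (ineqs n) (ineq_coeff n) ineq_rhs \<longleftrightarrow>
    x (0, n) \<le> 1 \<and>
    (\<forall>i\<in>{1..n-1}. x (i, n) \<le> x (i-1, n)) \<and>
    (\<forall>i\<in>{1..n-1}. x (0, i) \<le> x (0, i+1)) \<and>
    (\<forall>i\<in>{1..n-1}. x (i-1, i+1) \<le> x (i-1, i) + x (i, i+1)) \<and>
    (\<forall>j k. k \<le> n \<and> j + 2 < k \<longrightarrow> x (j, k) + x (j+1, k-1) \<le> x (j+1, k) + x (j, k-1))"
proof -
  let ?S = "\<lambda>r. \<Sum>v\<in>pair_vars n. ineq_coeff n r v * x v"
  note d = sum.distrib sum_subtractf distrib_right left_diff_distrib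
  have 1: "?S Upper = x (0, n)"
    using assms by (simp add: sum_unit_vec)
  have 2: "?S (To_End i) = x (i, n) - x (i-1, n)" if "i \<in> {1..n-1}" for i
  proof -
    have "0 < i" "i < n" "i - 1 < n" "i - 1 < i" "i - 1 < i + 1" "i + 1 \<le> n"
      using that assms by auto
    then show ?thesis by (simp add: d sum_unit_vec)
  qed
  have 3: "?S (From_Start i) = x (0, i) - x (0, i+1)" if "i \<in> {1..n-1}" for i
  proof -
    have "0 < i" "i < n" "i - 1 < n" "i - 1 < i" "i - 1 < i + 1" "i + 1 \<le> n"
      using that assms by auto
    then show ?thesis by (simp add: d sum_unit_vec)
  qed
  have 4: "?S (Triangle i) = x (i-1, i+1) - x (i-1, i) - x (i, i+1)" if "i \<in> {1..n-1}" for i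
  proof -
    have "0 < i" "i < n" "i - 1 < n" "i - 1 < i" "i - 1 < i + 1" "i + 1 \<le> n"
      using that assms by auto
    then show ?thesis by (simp add: d sum_unit_vec)
  qed
  have 5: "?S (Exchange j k) = x (j, k) + x (j+1, k-1) - x (j+1, k) - x (j, k-1)"
    if "k \<le> n \<and> j + 2 < k" for j k
  proof -
    have "j < k" "j + 1 < k - 1" "j + 1 < k" "j < k - 1" "k \<le> n" "k - 1 \<le> n"
      using that by auto
    then show ?thesis by (simp add: d sum_unit_vec)
  qed
  have "x \<in> primal_feasible (pair_vars n) (ineqs n) (ineq_coeff n) ineq_rhs \<longleftrightarrow>
    ?S Upper \<le> 1 \<and> (\<forall>i\<in>{1..n-1}. ?S (To_End i) \<le> 0) \<and> (\<forall>i\<in>{1..n-1}. ?S (From_Start i) \<le> 0) \<and>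
    (\<forall>i\<in>{1..n-1}. ?S (Triangle i) \<le> 0) \<and> (\<forall>j k. k \<le> n \<and> j + 2 < k \<longrightarrow> ?S (Exchange j k) \<le> 0)"
  proof -
    have "(\<forall>r\<in>{Exchange j k | j k. k \<le> n \<and> j + 2 < k}. ?S r \<le> ineq_rhs r) \<longleftrightarrow>
      (\<forall>j k. k \<le> n \<and> j + 2 < k \<longrightarrow> ?S (Exchange j k) \<le> ineq_rhs (Exchange j k))"
      by blast
    then show ?thesis
      unfolding primal_feasible_def ineqs_def mem_Collect_eq ball_Un
      by (simp del: ineq_coeff.simps)
  qed
  also have "\<dots> \<longleftrightarrow> x (0, n) \<le> 1 \<and>
    (\<forall>i\<in>{1..n-1}. x (i, n) - x (i-1, n) \<le> 0) \<and>
    (\<forall>i\<in>{1..n-1}. x (0, i) - x (0, i+1) \<le> 0) \<and>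
    (\<forall>i\<in>{1..n-1}. x (i-1, i+1) - x (i-1, i) - x (i, i+1) \<le> 0) \<and>
    (\<forall>j k. k \<le> n \<and> j + 2 < k \<longrightarrow>
      x (j, k) + x (j+1, k-1) - x (j+1, k) - x (j, k-1) \<le> 0)"
    by (simp only: 1 2 3 4 5 cong: ball_cong imp_cong)
  finally show ?thesis
    by (simp only: diff_le_eq add_0 add_ac)
qed

end

theory Submission
  imports Defs
begin

text \<open>
  For a set \<open>S\<close> of indices in \<open>{0, \<dots>, n - 1}\<close> the 0/1-vector \<open>x\<^sub>S\<close> with \<open>x\<^sub>S (i, j) = 1\<close> iff \<open>S\<close>
  meets \<open>{i, \<dots>, j - 1}\<close> is feasible, the exchange inequalities being submodularity of
  \<open>A \<mapsto> [S \<inter> A \<noteq> \<emptyset>]\<close>. In suitable unimodular coordinates the system describes flows of value at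
  most 1 in an acyclic network whose paths are exactly the nonempty sets \<open>S\<close>. Hence the optimum
  is the largest weight \<open>u\<close> of a set \<open>S\<close>, and the largest weights of sets with a prescribed maximum
  are node potentials, from which an integral dual solution of value \<open>u\<close> is read off.
\<close>

section \<open>Weak duality and feasibility of the 0/1-vectors\<close>

lemma weak_duality:
  assumes "x \<in> primal_feasible V R A b" "y \<in> dual_feasible V R A c"
  shows "(\<Sum>v\<in>V. c v * x v) \<le> (\<Sum>r\<in>R. y r * b r)"
proof -
  have "(\<Sum>v\<in>V. c v * x v) = (\<Sum>v\<in>V. (\<Sum>r\<in>R. y r * A r v) * x v)"
    using assms(2) by (intro sum.cong) (auto simp: dual_feasible_def)
  also have "\<dots> = (\<Sum>v\<in>V. \<Sum>r\<in>R. y r * (A r v * x v))"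
    by (simp add: sum_distrib_right mult.assoc)
  also have "\<dots> = (\<Sum>r\<in>R. y r * (\<Sum>v\<in>V. A r v * x v))"
    by (subst sum.swap) (simp add: sum_distrib_left)
  also have "\<dots> \<le> (\<Sum>r\<in>R. y r * b r)"
    using assms by (intro sum_mono mult_left_mono) (auto simp: primal_feasible_def dual_feasible_def)
  finally show ?thesis .
qed

definition hits :: "nat set \<Rightarrow> nat \<times> nat \<Rightarrow> real" where
  "hits S v = (if S \<inter> {fst v..<snd v} \<noteq> {} then 1 else 0)"

lemma hits_mono: "a' \<le> a \<Longrightarrow> b \<le> b' \<Longrightarrow> hits S (a, b) \<le> hits S (a', b')"
  using ivl_subset[of a b a' b'] unfolding hits_def fst_conv snd_conv by auto

text \<open>All four intervals share the middle \<open>{j+1..<k-1}\<close>. If \<open>S\<close>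
  meets it, both sides are 2; otherwise this is the union bound for \<open>j\<close> and
  \<open>k - 1\<close>.\<close>

lemma hits_exchange:
  assumes "j + 2 < k"
  shows "hits S (j, k) + hits S (j+1, k-1) \<le> hits S (j+1, k) + hits S (j, k-1)"
proof -
  have 1: "{j..<k} = insert j (insert (k-1) {j+1..<k-1})" and 2: "{j+1..<k} = insert (k-1) {j+1..<k-1}"
    and 3: "{j..<k-1} = insert j {j+1..<k-1}"
    using assms by auto
  show ?thesis
    unfolding hits_def fst_conv snd_conv 1 2 3 by auto
qed

lemma hits_primal_feasible:
  assumes "n \<ge> 2"
  shows "hits S \<in> primal_feasible (pair_vars n) (ineqs n) (ineq_coeff n) ineq_rhs"
  unfolding primal_feasible_ineqs_iff[OF assms]
proof (intro conjI ballI allI impI)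
  show "hits S (0, n) \<le> 1" by (simp add: hits_def)
next
  fix i assume "i \<in> {1..n-1}"
  show "hits S (i, n) \<le> hits S (i-1, n)" "hits S (0, i) \<le> hits S (0, i+1)"
    by (simp_all add: hits_mono)
  have "{i-1..<i+1} = {i-1..<i} \<union> {i..<i+1}" using \<open>i \<in> {1..n-1}\<close> by auto
  then show "hits S (i-1, i+1) \<le> hits S (i-1, i) + hits S (i, i+1)"
    unfolding hits_def fst_conv snd_conv by auto
next
  fix j k assume "k \<le> n \<and> j + 2 < k"
  then show "hits S (j, k) + hits S (j+1, k-1) \<le> hits S (j+1, k) + hits S (j, k-1)"
    by (intro hits_exchange) auto
qed

section \<open>Weights of index sets\<close>

text \<open>Cumulative form of \<open>c\<close>: for \<open>i < j\<close>, the total over intervals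
  \<open>{a..<b}\<close> containing both \<open>i\<close> and \<open>j - 1\<close>.\<close>

definition cover_weight :: "nat \<Rightarrow> (nat \<times> nat \<Rightarrow> real) \<Rightarrow> nat \<Rightarrow> nat \<Rightarrow> real" where
  "cover_weight n c i j = (\<Sum>v\<in>pair_vars n. if fst v \<le> i \<and> j \<le> snd v then c v else 0)"

definition weight :: "nat \<Rightarrow> (nat \<times> nat \<Rightarrow> real) \<Rightarrow> nat set \<Rightarrow> real" where
  "weight n c S = (\<Sum>v\<in>pair_vars n. c v * hits S v)"

lemma cover_weight_beyond: "n < j \<Longrightarrow> cover_weight n c i j = 0"
  unfolding cover_weight_def by (intro sum.neutral) (auto simp: pair_vars_def)

text \<open>Differencing in \<open>j\<close> fixes the second entry, differencing in
  \<open>i\<close> the first. At \<open>i = 0\<close> the subtracted sum would be empty.\<close>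

lemma cover_weight_mixed_difference:
  assumes "i < j" "j \<le> n"
  shows "cover_weight n c i j - cover_weight n c i (j+1)
    - (if i = 0 then 0 else cover_weight n c (i-1) j - cover_weight n c (i-1) (j+1)) = c (i, j)"
proof -
  have "cover_weight n c i j - cover_weight n c i (j+1)
    - (if i = 0 then 0 else cover_weight n c (i-1) j - cover_weight n c (i-1) (j+1))
    = (\<Sum>v\<in>pair_vars n. if v = (i, j) then c v else 0)"
    by (cases "i = 0") (simp_all add: cover_weight_def flip: sum_subtractf,
        (rule sum.cong; auto simp: not_less_eq_eq)+)
  also have "\<dots> = c (i, j)"
    using assms by (simp add: finite_pair_vars) (simp add: pair_vars_def)
  finally show ?thesis .
qed

lemma weight_empty: "weight n c {} = 0"
  by (simp add: weight_def hits_def)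

lemma weight_singleton: "weight n c {l} = cover_weight n c l (l+1)"
  unfolding weight_def cover_weight_def by (rule sum.cong) (auto simp: hits_def)

text \<open>An interval containing \<open>l\<close> meets \<open>S\<close> iff it contains the
  maximum \<open>j\<close> of \<open>S\<close>. So the gain depends only on \<open>j\<close> and
  \<open>l\<close>: it is an arc length.\<close>

lemma weight_insert:
  assumes "S \<subseteq> {..j}" "j \<in> S" "j < l"
  shows "weight n c (insert l S) = weight n c S + cover_weight n c l (l+1) - cover_weight n c j (l+1)"
  unfolding weight_def cover_weight_def sum.distrib[symmetric] sum_subtractf[symmetric]
proof (rule sum.cong)
  fix v :: "nat \<times> nat"
  obtain a b where v: "v = (a, b)" by fastforce
  have *: "S \<inter> {a..<b} \<noteq> {} \<longleftrightarrow> a \<le> j" if "a \<le> l" "l < b"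
    using assms that by auto
  show "c v * hits (insert l S) v = c v * hits S v + (if fst v \<le> l \<and> l + 1 \<le> snd v then c v else 0)
    - (if fst v \<le> j \<and> l + 1 \<le> snd v then c v else 0)"
  proof (cases "a \<le> l \<and> l < b")
    case True
    then show ?thesis using * assms by (auto simp: v hits_def)
  next
    case False
    then have "insert l S \<inter> {a..<b} = S \<inter> {a..<b}" by auto
    with False assms show ?thesis by (auto simp: v hits_def)
  qed
qed simp

lemma cover_weight_Ints: "\<forall>v\<in>pair_vars n. c v \<in> \<int> \<Longrightarrow> cover_weight n c i j \<in> \<int>"
  unfolding cover_weight_def by (intro Ints_sum) auto

lemma weight_Ints: "\<forall>v\<in>pair_vars n. c v \<in> \<int> \<Longrightarrow> weight n c S \<in> \<int>"
  unfolding weight_def by (intro Ints_sum) (auto simp: hits_def)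

section \<open>Uniform indexing of the rows\<close>

text \<open>With \<open>x (i, i) = 0\<close>, the triangle inequality \<open>Triangle i\<close> is the exchange inequality for
  \<open>(i - 1, i + 1)\<close>.\<close>

definition exchange_row :: "nat \<times> nat \<Rightarrow> ineq" where
  "exchange_row = (\<lambda>(j, k). if k = j + 2 then Triangle (j + 1) else Exchange j k)"

definition exchange_pairs :: "nat \<Rightarrow> (nat \<times> nat) set" where
  "exchange_pairs n = {(j, k). k \<le> n \<and> j + 2 \<le> k}"

lemma finite_exchange_pairs: "finite (exchange_pairs n)"
  by (rule finite_subset[of _ "{..n} \<times> {..n}"]) (auto simp: exchange_pairs_def)

lemma inj_exchange_row: "inj exchange_row"
  by (auto simp: inj_def exchange_row_def split: if_splits)

lemma ineqs_eq:
  "ineqs n = {Upper} \<union> To_End ` {1..n-1} \<union> From_Start ` {1..n-1} \<union> exchange_row ` exchange_pairs n"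
proof -
  have "Triangle ` {1..n-1} \<union> {Exchange j k | j k. k \<le> n \<and> j + 2 < k} = exchange_row ` exchange_pairs n"
  proof (intro equalityI subsetI)
    fix r assume "r \<in> Triangle ` {1..n-1} \<union> {Exchange j k | j k. k \<le> n \<and> j + 2 < k}"
    then consider i where "r = Triangle i" "1 \<le> i" "i \<le> n - 1"
      | j k where "r = Exchange j k" "k \<le> n" "j + 2 < k" by auto
    then show "r \<in> exchange_row ` exchange_pairs n"
    proof cases
      case 1
      then show ?thesis
        by (intro image_eqI[of _ _ "(i-1, i+1)"]) (auto simp: exchange_row_def exchange_pairs_def)
    next
      case 2
      then show ?thesis
        by (intro image_eqI[of _ _ "(j, k)"]) (auto simp: exchange_row_def exchange_pairs_def)
    qed
  next
    fix r assume "r \<in> exchange_row ` exchange_pairs n"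
    then obtain j k where "r = exchange_row (j, k)" "k \<le> n" "j + 2 \<le> k"
      by (auto simp: exchange_pairs_def)
    then show "r \<in> Triangle ` {1..n-1} \<union> {Exchange j k | j k. k \<le> n \<and> j + 2 < k}"
      by (cases "k = j + 2") (auto simp: exchange_row_def)
  qed
  then show ?thesis unfolding ineqs_def by (simp add: Un_assoc)
qed

lemma finite_ineqs: "finite (ineqs n)"
  unfolding ineqs_eq by (simp add: finite_exchange_pairs)

lemma sum_ineqs:
  fixes F :: "ineq \<Rightarrow> real"
  shows "(\<Sum>r\<in>ineqs n. F r) = F Upper + (\<Sum>i\<in>{1..n-1}. F (To_End i))
    + (\<Sum>i\<in>{1..n-1}. F (From_Start i)) + (\<Sum>q\<in>exchange_pairs n. F (exchange_row q))"
proof -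
  have "sum F (exchange_row ` exchange_pairs n) = (\<Sum>q\<in>exchange_pairs n. F (exchange_row q))"
    using inj_exchange_row by (subst sum.reindex) (auto intro: inj_on_subset)
  moreover have "sum F (To_End ` {1..n-1}) = (\<Sum>i\<in>{1..n-1}. F (To_End i))"
    by (subst sum.reindex) (auto simp: inj_on_def)
  moreover have "sum F (From_Start ` {1..n-1}) = (\<Sum>i\<in>{1..n-1}. F (From_Start i))"
    by (subst sum.reindex) (auto simp: inj_on_def)
  moreover have "sum F (ineqs n) = sum F {Upper} + sum F (To_End ` {1..n-1})
      + sum F (From_Start ` {1..n-1}) + sum F (exchange_row ` exchange_pairs n)"
    unfolding ineqs_eq
    by (subst sum.union_disjoint;
        (force simp: finite_exchange_pairs exchange_row_def split: if_splits)?)+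
  ultimately show ?thesis by simp
qed

section \<open>Column sums in the dual equations\<close>

text \<open>\<open>B\<close> guards against a candidate \<open>q0\<close> faked by truncated
  subtraction, such as \<open>i - 1\<close> at \<open>i = 0\<close>.\<close>

lemma sum_mult_indicator_unique:
  fixes f :: "'a \<Rightarrow> real"
  assumes "finite P" "\<And>q. q \<in> P \<Longrightarrow> Q q \<longleftrightarrow> B \<and> q = q0"
  shows "(\<Sum>q\<in>P. f q * (if Q q then 1 else 0)) = (if B \<and> q0 \<in> P then f q0 else 0)"
proof -
  have "(\<Sum>q\<in>P. f q * (if Q q then 1 else 0)) = (\<Sum>q\<in>P. if q = q0 then if B then f q0 else 0 else 0)"
    using assms(2) by (intro sum.cong) auto
  then show ?thesis using assms(1) by simp
qed

text \<open>A variable occurs in at most four exchange rows, giving a mixed difference of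
  \<open>E\<close> with missing rows dropped. \<open>diag\<close> covers \<open>j = i + 1\<close>,
  which has no row of its own.\<close>

lemma sum_exchange_rows:
  assumes "i < j" "j \<le> n" and diag: "\<And>i. i < n \<Longrightarrow> E i (i+1) = 0"
  shows "(\<Sum>q\<in>exchange_pairs n. E (fst q) (snd q) * ineq_coeff n (exchange_row q) (i, j))
    = E i j - (if j = n then 0 else E i (j+1))
      - (if i = 0 then 0 else E (i-1) j - (if j = n then 0 else E (i-1) (j+1)))"
proof -
  let ?P = "exchange_pairs n" and ?E = "\<lambda>q. E (fst q) (snd q)"
  \<comment> \<open>In a triangle row the second indicator names a diagonal pair, excluded by
    \<open>i < j\<close>, so one formula serves both kinds of row.\<close>
  have coeff: "ineq_coeff n (exchange_row q) (i, j) =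
      (if (i, j) = (fst q, snd q) then 1 else 0) + (if (i, j) = (fst q + 1, snd q - 1) then 1 else 0)
      - (if (i, j) = (fst q + 1, snd q) then 1 else 0) - (if (i, j) = (fst q, snd q - 1) then 1 else 0)"
    if "q \<in> ?P" for q
    using assms(1) by (cases q) (auto simp: exchange_row_def unit_vec_def)
  have 1: "(\<Sum>q\<in>?P. ?E q * (if (i, j) = (fst q, snd q) then 1 else 0)) = E i j"
  proof -
    have "E i j = 0" if "(i, j) \<notin> ?P"
    proof -
      have "j = i + 1" using that assms(1,2) by (auto simp: exchange_pairs_def)
      then show ?thesis using diag[of i] assms(2) by simp
    qed
    then show ?thesis
      by (subst sum_mult_indicator_unique[OF finite_exchange_pairs, where B = True and ?q0.0 = "(i, j)"])
        auto
  qed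
  have 2: "(\<Sum>q\<in>?P. ?E q * (if (i, j) = (fst q + 1, snd q - 1) then 1 else 0))
      = (if i = 0 \<or> j = n then 0 else E (i-1) (j+1))"
    using assms
    by (subst sum_mult_indicator_unique[OF finite_exchange_pairs, where B = "i > 0" and ?q0.0 = "(i-1, j+1)"])
      (auto simp: exchange_pairs_def)
  have 3: "(\<Sum>q\<in>?P. ?E q * (if (i, j) = (fst q + 1, snd q) then 1 else 0))
      = (if i = 0 then 0 else E (i-1) j)"
    using assms
    by (subst sum_mult_indicator_unique[OF finite_exchange_pairs, where B = "i > 0" and ?q0.0 = "(i-1, j)"])
      (auto simp: exchange_pairs_def)
  have 4: "(\<Sum>q\<in>?P. ?E q * (if (i, j) = (fst q, snd q - 1) then 1 else 0))
      = (if j = n then 0 else E i (j+1))"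
    using assms
    by (subst sum_mult_indicator_unique[OF finite_exchange_pairs, where B = True and ?q0.0 = "(i, j+1)"])
      (auto simp: exchange_pairs_def)
  have "(\<Sum>q\<in>?P. ?E q * ineq_coeff n (exchange_row q) (i, j))
      = E i j + (if i = 0 \<or> j = n then 0 else E (i-1) (j+1))
        - (if i = 0 then 0 else E (i-1) j) - (if j = n then 0 else E i (j+1))"
    unfolding 1[symmetric] 2[symmetric] 3[symmetric] 4[symmetric]
      sum.distrib[symmetric] sum_subtractf[symmetric]
    by (rule sum.cong) (simp_all only: coeff ring_distribs)
  then show ?thesis by auto
qed

lemma sum_To_End_rows:
  assumes "i < j" "j \<le> n" "n \<ge> 2"
  shows "(\<Sum>k\<in>{1..n-1}. a k * ineq_coeff n (To_End k) (i, j))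
    = (if j = n then (if i = 0 then 0 else a i) - (if i = n - 1 then 0 else a (i+1)) else 0)"
proof -
  have 1: "(\<Sum>k\<in>{1..n-1}. a k * (if (i, j) = (k, n) then 1 else 0)) = (if j = n \<and> i \<noteq> 0 then a i else 0)"
    using assms
    by (subst sum_mult_indicator_unique[where B = "j = n" and ?q0.0 = i]) auto
  have 2: "(\<Sum>k\<in>{1..n-1}. a k * (if (i, j) = (k-1, n) then 1 else 0))
      = (if j = n \<and> i \<noteq> n - 1 then a (i+1) else 0)"
    using assms
    by (subst sum_mult_indicator_unique[where B = "j = n" and ?q0.0 = "i+1"]) auto
  show ?thesis
    using 1 2 by (simp add: unit_vec_def right_diff_distrib sum_subtractf)
qed

lemma sum_From_Start_rows:
  assumes "i < j" "j \<le> n" "n \<ge> 2"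
  shows "(\<Sum>k\<in>{1..n-1}. b k * ineq_coeff n (From_Start k) (i, j))
    = (if i = 0 then (if j = n then 0 else b j) - (if j = 1 then 0 else b (j-1)) else 0)"
proof -
  have 1: "(\<Sum>k\<in>{1..n-1}. b k * (if (i, j) = (0, k) then 1 else 0)) = (if i = 0 \<and> j \<noteq> n then b j else 0)"
    using assms
    by (subst sum_mult_indicator_unique[where B = "i = 0" and ?q0.0 = j]) auto
  have 2: "(\<Sum>k\<in>{1..n-1}. b k * (if (i, j) = (0, k+1) then 1 else 0))
      = (if i = 0 \<and> j \<noteq> 1 then b (j-1) else 0)"
    using assms
    by (subst sum_mult_indicator_unique[where B = "i = 0" and ?q0.0 = "j-1"]) auto
  show ?thesis
    using 1 2 by (simp add: unit_vec_def right_diff_distrib sum_subtractf)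
qed

section \<open>From potentials to a dual solution\<close>

text \<open>Expressing every \<open>x (j, k)\<close> through the \<open>x (i, i + 1)\<close> and the slacks of the exchange
  inequalities, and comparing coefficients, determines all multipliers from \<open>H i\<close>, the value of
  \<open>Upper\<close> minus the multiplier of \<open>To_End (i + 1)\<close>. Since there is no \<open>To_End n\<close> and no
  \<open>From_Start 0\<close>, this forces the boundary values of \<open>H\<close> at \<open>n - 1\<close> and \<open>0\<close>.\<close>

lemma integral_dual_of_potential:
  fixes H :: "nat \<Rightarrow> real"
  assumes n: "n \<ge> 2" and c: "\<forall>v\<in>pair_vars n. c v \<in> \<int>"
    and H_Ints: "\<And>i. H i \<in> \<int>"
    and u: "0 \<le> H (n-1)" "\<And>i. i < n \<Longrightarrow> H i \<le> H (n-1)"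
    and H0: "H 0 = cover_weight n c 0 1"
    and start: "\<And>i. i < n \<Longrightarrow> cover_weight n c i (i+1) \<le> H i"
    and step: "\<And>j l. j < l \<Longrightarrow> l < n \<Longrightarrow>
      H j + cover_weight n c l (l+1) - cover_weight n c j (l+1) \<le> H l"
  shows "\<exists>y\<in>dual_feasible (pair_vars n) (ineqs n) (ineq_coeff n) c.
    (\<forall>r\<in>ineqs n. y r \<in> \<int>) \<and> (\<Sum>r\<in>ineqs n. y r * ineq_rhs r) = H (n-1)"
proof -
  let ?C = "cover_weight n c"
  \<comment> \<open>\<open>E j k\<close> is the slack of \<open>step\<close> on the arc from
    \<open>j\<close> to \<open>k - 1\<close>; it vanishes at \<open>k = j + 1\<close>, as
    \<open>diag\<close> demands.\<close>
  define E where "E j k = ?C j k - H j + (H (k-1) - ?C (k-1) k)" for j k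
  define y where "y r = (case r of Upper \<Rightarrow> H (n-1) | To_End i \<Rightarrow> H (n-1) - H (i-1)
    | From_Start i \<Rightarrow> H i - ?C i (i+1) | Triangle i \<Rightarrow> E (i-1) (i+1) | Exchange j k \<Rightarrow> E j k)" for r
  have y_simps: "y Upper = H (n-1)" "y (To_End i) = H (n-1) - H (i-1)"
    "y (From_Start i) = H i - ?C i (i+1)" for i
    by (simp_all add: y_def)
  have y_exchange: "y (exchange_row q) = E (fst q) (snd q)" for q
    by (auto simp: y_def exchange_row_def split: prod.splits)
  have E_nonneg: "0 \<le> E j k" if "(j, k) \<in> exchange_pairs n" for j k
  proof -
    have "j < k - 1" "k - 1 < n" "k - 1 + 1 = k" using that by (auto simp: exchange_pairs_def)
    then show ?thesis using step[of j "k-1"] by (simp add: E_def)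
  qed
  have nonneg: "0 \<le> y r" if r: "r \<in> ineqs n" for r
  proof -
    consider "r = Upper" | i where "i \<in> {1..n-1}" "r = To_End i" | i where "i \<in> {1..n-1}" "r = From_Start i"
      | q where "q \<in> exchange_pairs n" "r = exchange_row q"
      using r unfolding ineqs_eq by blast
    then show ?thesis
    proof cases
      case 2
      then have "i - 1 < n" using n by auto
      then show ?thesis using u 2 by (simp add: y_simps)
    next
      case 3
      then have "i < n" using n by auto
      then show ?thesis using start[of i] 3 by (simp add: y_simps)
    next
      case 4
      then show ?thesis using E_nonneg[of "fst q" "snd q"] by (simp add: y_exchange)
    qed (use u(1) in \<open>simp add: y_simps\<close>)
  qed
  have y_Ints: "y r \<in> \<int>" for r
    using H_Ints cover_weight_Ints[OF c] by (cases r) (auto simp: y_def E_def)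
  have "(\<Sum>r\<in>ineqs n. y r * ineq_coeff n r (i, j)) = c (i, j)" if ij: "i < j" "j \<le> n" for i j
  proof -
    have exch: "(\<Sum>q\<in>exchange_pairs n. y (exchange_row q) * ineq_coeff n (exchange_row q) (i, j))
      = E i j - (if j = n then 0 else E i (j+1))
        - (if i = 0 then 0 else E (i-1) j - (if j = n then 0 else E (i-1) (j+1)))"
      unfolding y_exchange by (rule sum_exchange_rows[OF ij]) (simp add: E_def)
    note sums = sum_ineqs exch sum_To_End_rows[OF ij n] sum_From_Start_rows[OF ij n] y_simps
    have "?C i (n+1) = 0" "?C (i-1) (n+1) = 0" by (simp_all add: cover_weight_beyond)
    moreover have "j - 1 + 1 = j" using ij by simp
    \<comment> \<open>The \<open>?C j k\<close> part of \<open>E\<close> yields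
      \<open>c (i, j)\<close>. Its other terms depend on one index each and cancel, except at
      \<open>j = n\<close>, where \<open>To_End\<close> and \<open>Upper\<close> compensate, and at
      \<open>i = 0\<close>, where \<open>From_Start\<close> does. The absent \<open>To_End n\<close>
      and \<open>From_Start 0\<close> would have multiplier 0, the latter by
      \<open>H0\<close>.\<close>
    ultimately show ?thesis
      using cover_weight_mixed_difference[OF ij, of c] ij n H0
      unfolding sums E_def
      by (cases "i = 0"; cases "j = n"; cases "i = n - 1"; cases "j = 1"; simp add: unit_vec_def)
  qed
  then have "y \<in> dual_feasible (pair_vars n) (ineqs n) (ineq_coeff n) c"
    using nonneg by (auto simp: dual_feasible_def pair_vars_def)
  moreover have "ineq_rhs (exchange_row q) = 0" for q
    by (auto simp: exchange_row_def split: prod.splits)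
  then have "(\<Sum>r\<in>ineqs n. y r * ineq_rhs r) = H (n-1)"
    by (simp add: sum_ineqs y_simps)
  ultimately show ?thesis using y_Ints by blast
qed

section \<open>Longest-path potentials\<close>

lemma exists_potential:
  assumes "n \<ge> 2" and c: "\<forall>v\<in>pair_vars n. c v \<in> \<int>"
  obtains H S where "\<And>i. H i \<in> \<int>" "H (n-1) = weight n c S" "0 \<le> H (n-1)"
    "\<And>i. i < n \<Longrightarrow> H i \<le> H (n-1)" "H 0 = cover_weight n c 0 1"
    "\<And>i. i < n \<Longrightarrow> cover_weight n c i (i+1) \<le> H i"
    "\<And>j l. j < l \<Longrightarrow> l < n \<Longrightarrow> H j + cover_weight n c l (l+1) - cover_weight n c j (l+1) \<le> H l"
proof -
  define ends where "ends l = {S. S \<subseteq> {..l} \<and> l \<in> S}" for l :: nat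
  define h where "h l = Max (weight n c ` ends l)" for l
  define u where "u = Max (weight n c ` Pow {..<n})"
  \<comment> \<open>The last node gets the overall maximum \<open>u\<close>, which also ranges over
    the empty set and so is nonnegative. Raising it preserves \<open>step\<close>-type inequalities,
    since \<open>n - 1\<close> is never the tail of an arc.\<close>
  define H where "H l = (if l = n - 1 then u else h l)" for l
  have fin: "finite (ends l)" for l
    by (rule finite_subset[of _ "Pow {..l}"]) (auto simp: ends_def)
  have sing: "{l} \<in> ends l" for l by (simp add: ends_def)
  have h_ge: "weight n c S \<le> h l" if "S \<in> ends l" for S l
    unfolding h_def using that fin by (intro Max_ge) auto
  have h_attained: "\<exists>S\<in>ends l. h l = weight n c S" for l
  proof -
    have "h l \<in> weight n c ` ends l"
      unfolding h_def using fin sing by (intro Max_in) auto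
    then show ?thesis by auto
  qed
  have u_ge: "weight n c S \<le> u" if "S \<subseteq> {..<n}" for S
    unfolding u_def using that by (intro Max_ge) auto
  have "u \<in> weight n c ` Pow {..<n}"
    unfolding u_def by (intro Max_in) auto
  then obtain S where S: "u = weight n c S" by auto
  have h_le_u: "h i \<le> u" if "i < n" for i
  proof -
    obtain T where "T \<in> ends i" "h i = weight n c T" using h_attained by blast
    then show ?thesis using u_ge[of T] that by (fastforce simp: ends_def)
  qed
  have h_le_H: "h i \<le> H i" if "i < n" for i
    using h_le_u that by (simp add: H_def)
  show thesis
  proof (rule that)
    show "H i \<in> \<int>" for i
      using h_attained[of i] S weight_Ints[OF c] by (auto simp: H_def)
    show "H (n-1) = weight n c S" using S by (simp add: H_def)
    show "0 \<le> H (n-1)" using u_ge[of "{}"] by (simp add: H_def weight_empty)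
    show "H i \<le> H (n-1)" if "i < n" for i using h_le_u that by (simp add: H_def)
    \<comment> \<open>\<open>n \<ge> 2\<close> keeps node \<open>0\<close> apart from the raised
      node \<open>n - 1\<close>.\<close>
    have "ends 0 = {{0}}" by (auto simp: ends_def)
    then show "H 0 = cover_weight n c 0 1"
      using assms(1) by (simp add: H_def h_def weight_singleton)
    show "cover_weight n c i (i+1) \<le> H i" if "i < n" for i
      using h_ge[OF sing[of i]] h_le_H[OF that] by (simp add: weight_singleton)
    show "H j + cover_weight n c l (l+1) - cover_weight n c j (l+1) \<le> H l" if "j < l" "l < n" for j l
    proof -
      obtain T where T: "T \<in> ends j" "h j = weight n c T" using h_attained by blast
      then have "insert l T \<in> ends l" using \<open>j < l\<close> by (auto simp: ends_def)
      from h_ge[OF this] have "h j + cover_weight n c l (l+1) - cover_weight n c j (l+1) \<le> h l"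
        using T \<open>j < l\<close> by (subst (asm) weight_insert[of _ j]) (auto simp: ends_def)
      moreover have "j \<noteq> n - 1" using that by simp
      then have "H j = h j" by (simp add: H_def)
      ultimately show ?thesis using h_le_H[OF \<open>l < n\<close>] by simp
    qed
  qed
qed

section \<open>Rationality and total dual integrality\<close>

lemma ineq_coeff_Rats: "ineq_coeff n r v \<in> \<rat>"
  by (cases r) (auto simp: unit_vec_def)

lemma ineq_rhs_Rats: "ineq_rhs r \<in> \<rat>"
  by (cases r) auto

theorem theorem6p13:
  fixes n :: nat
  assumes "n \<ge> 2"
  shows "totally_dual_integral (pair_vars n) (ineqs n) (ineq_coeff n) ineq_rhs"
  unfolding totally_dual_integral_def
proof (intro conjI allI impI ballI)
  fix c :: "nat \<times> nat \<Rightarrow> real"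
  assume c: "\<forall>v\<in>pair_vars n. c v \<in> \<int>"
  let ?D = "dual_feasible (pair_vars n) (ineqs n) (ineq_coeff n) c"
  obtain H S where H: "\<And>i. H i \<in> \<int>" "H (n-1) = weight n c S" "0 \<le> H (n-1)"
    "\<And>i. i < n \<Longrightarrow> H i \<le> H (n-1)" "H 0 = cover_weight n c 0 1"
    "\<And>i. i < n \<Longrightarrow> cover_weight n c i (i+1) \<le> H i"
    "\<And>j l. j < l \<Longrightarrow> l < n \<Longrightarrow> H j + cover_weight n c l (l+1) - cover_weight n c j (l+1) \<le> H l"
    using exists_potential[OF assms c] by blast
  from integral_dual_of_potential[OF assms c H(1) H(3-7)]
  obtain y where y: "y \<in> ?D" "\<forall>r\<in>ineqs n. y r \<in> \<int>" "(\<Sum>r\<in>ineqs n. y r * ineq_rhs r) = H (n-1)"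
    by blast
  \<comment> \<open>The feasible \<open>hits S\<close> has objective value \<open>H (n-1)\<close>,
    the value of \<open>y\<close>, and so certifies that \<open>y\<close> is optimal.\<close>
  have "(\<Sum>r\<in>ineqs n. y r * ineq_rhs r) \<le> (\<Sum>r\<in>ineqs n. z r * ineq_rhs r)" if "z \<in> ?D" for z
    using weak_duality[OF hits_primal_feasible[OF assms] that, of S] y(3) H(2)
    by (simp add: weight_def)
  with y show "\<exists>y\<in>?D. (\<forall>r\<in>ineqs n. y r \<in> \<int>) \<and>
      (\<forall>z\<in>?D. (\<Sum>r\<in>ineqs n. y r * ineq_rhs r) \<le> (\<Sum>r\<in>ineqs n. z r * ineq_rhs r))"
    by blast
qed (simp_all add: finite_pair_vars finite_ineqs ineq_coeff_Rats ineq_rhs_Rats)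

end
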